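(* The decision variant of MaxCut on split graphs can be solved in time $2^{O(\sqrt{k})}\cdot\mathrm{poly}$.
   Context: All graphs are finite and simple. A split graph is a graph whose vertex set can be partitioned into a clique and an independent set. A cut of a graph $G=(V,E)$ is a partition $(V_1,V_2)$ of $V$; its size is the number of edges with one endpoint in $V_1$ and the other in $V_2$. Decision variant of MaxCut: given a graph $G$ and an integer $k$, decide whether $G$ has a cut of size at least $k$. "poly" denotes a factor polynomial in the input size. *)

theory Defs
  imports Complex_Main "HOL-Library.Landau_Symbols" "HOL-Library.Log_Nat"
    "HOL-Library.Ramsey" "HOL-Computational_Algebra.Polynomial"
begin

section \<open>Graphs, split graphs and cuts\<close>

definition simple_graph :: "'a set \<Rightarrow> 'a set set \<Rightarrow> bool" where
  "simple_graph V E \<longleftrightarrow> finite V \<and> E \<subseteq> [V]\<^bsup>2\<^esup>"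

definition clique :: "'a set \<Rightarrow> 'a set set \<Rightarrow> bool" where
  "clique C E \<longleftrightarrow> (\<forall>u\<in>C. \<forall>v\<in>C. u \<noteq> v \<longrightarrow> {u, v} \<in> E)"

definition independent :: "'a set \<Rightarrow> 'a set set \<Rightarrow> bool" where
  "independent I E \<longleftrightarrow> (\<forall>u\<in>I. \<forall>v\<in>I. {u, v} \<notin> E)"

definition split_graph :: "'a set \<Rightarrow> 'a set set \<Rightarrow> bool" where
  "split_graph V E \<longleftrightarrow> simple_graph V E \<and>
     (\<exists>C I. C \<union> I = V \<and> C \<inter> I = {} \<and> clique C E \<and> independent I E)"

text \<open>A side of a cut may be empty.\<close>

definition is_cut :: "'a set \<Rightarrow> 'a set \<Rightarrow> 'a set \<Rightarrow> bool" where
  "is_cut V V1 V2 \<longleftrightarrow> V1 \<union> V2 = V \<and> V1 \<inter> V2 = {}"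

definition cut_size :: "'a set set \<Rightarrow> 'a set \<Rightarrow> 'a set \<Rightarrow> nat" where
  "cut_size E V1 V2 = card {e \<in> E. \<exists>u\<in>V1. \<exists>v\<in>V2. e = {u, v}}"

definition maxcut :: "'a set \<Rightarrow> 'a set set \<Rightarrow> nat \<Rightarrow> bool" where
  "maxcut V E k \<longleftrightarrow> (\<exists>V1 V2. is_cut V V1 V2 \<and> k \<le> cut_size E V1 V2)"

section \<open>Random access machines\<close>

text \<open>
  Programs of a unit-cost random access machine, with structured control flow instead of jumps.
  A program mentions finitely many registers; the memory is addressed indirectly through registers.
  Registers and memory cells hold natural numbers. The only arithmetic is addition and truncated
  subtraction, so that \<open>t\<close> steps lengthen the binary representations of the stored numbers
  by at most \<open>t\<close> bits (up to a constant depending on the program). Hence unit cost agrees with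
  Turing machine time up to a polynomial in the time and the bit length of the input.
\<close>

type_synonym reg = nat

datatype com =
    Const reg nat
  | Copy reg reg
  | Add reg reg reg
  | Sub reg reg reg
  | Load reg reg
  | Store reg reg
  | Seq com com
  | If reg com com
  | While reg com

text \<open>A state consists of the register contents and the memory contents.\<close>

type_synonym state = "(reg \<Rightarrow> nat) \<times> (nat \<Rightarrow> nat)"

text \<open>\<open>exec c s t s'\<close>: started in state \<open>s\<close>, the program \<open>c\<close> halts after exactly \<open>t\<close> steps in
  state \<open>s'\<close>. Each instruction and each evaluation of a test is one step; a test is whether a
  register is nonzero.\<close>

inductive exec :: "com \<Rightarrow> state \<Rightarrow> nat \<Rightarrow> state \<Rightarrow> bool" where
  Const: "exec (Const x n) (R, M) 1 (R(x := n), M)"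
| Copy:  "exec (Copy x y) (R, M) 1 (R(x := R y), M)"
| Add:   "exec (Add x y z) (R, M) 1 (R(x := R y + R z), M)"
| Sub:   "exec (Sub x y z) (R, M) 1 (R(x := R y - R z), M)"
| Load:  "exec (Load x y) (R, M) 1 (R(x := M (R y)), M)"
| Store: "exec (Store x y) (R, M) 1 (R, M(R x := R y))"
| Seq:   "exec c s t1 s' \<Longrightarrow> exec d s' t2 s'' \<Longrightarrow> exec (Seq c d) s (t1 + t2) s''"
| IfTrue:  "R x \<noteq> 0 \<Longrightarrow> exec c (R, M) t s' \<Longrightarrow> exec (If x c d) (R, M) (1 + t) s'"
| IfFalse: "R x = 0 \<Longrightarrow> exec d (R, M) t s' \<Longrightarrow> exec (If x c d) (R, M) (1 + t) s'"
| WhileFalse: "R x = 0 \<Longrightarrow> exec (While x c) (R, M) 1 (R, M)"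
| WhileTrue: "R x \<noteq> 0 \<Longrightarrow> exec c (R, M) t1 s' \<Longrightarrow> exec (While x c) s' t2 s'' \<Longrightarrow>
    exec (While x c) (R, M) (1 + t1 + t2) s''"

lemma exec_deterministic:
  "exec c s t s' \<Longrightarrow> exec c s u s'' \<Longrightarrow> t = u \<and> s' = s''"
proof (induction arbitrary: u s'' rule: exec.induct)
  case (Seq c s t1 s1 d t2 s2)
  from Seq.prems obtain u1 r u2 where "exec c s u1 r" "exec d r u2 s''" "u = u1 + u2"
    by cases simp
  with Seq.IH show ?case by metis
next
  case (IfTrue R x c M t s1 d)
  from IfTrue.prems IfTrue.hyps(1) obtain u1 where "exec c (R, M) u1 s''" "u = 1 + u1"
    by cases simp_all
  with IfTrue.IH show ?case by metis
next
  case (IfFalse R x d M t s1 c)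
  from IfFalse.prems IfFalse.hyps(1) obtain u1 where "exec d (R, M) u1 s''" "u = 1 + u1"
    by cases simp_all
  with IfFalse.IH show ?case by metis
next
  case (WhileFalse R x c M)
  from WhileFalse.prems WhileFalse.hyps(1) show ?case by cases simp_all
next
  case (WhileTrue R x c M t1 s1 t2 s2)
  from WhileTrue.prems WhileTrue.hyps(1) obtain u1 r u2
    where "exec c (R, M) u1 r" "exec (While x c) r u2 s''" "u = 1 + u1 + u2"
    by cases simp_all
  with WhileTrue.IH show ?case by metis
qed (erule exec.cases; simp)+

text \<open>The input is a list of numbers, placed in the memory cells from address 0 on.\<close>

definition initial_state :: "nat list \<Rightarrow> state" where
  "initial_state xs = (\<lambda>_. 0, \<lambda>i. if i < length xs then xs ! i else 0)"

text \<open>The program halts on the input \<open>xs\<close> within \<open>T\<close> steps, and its answer, read off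
  register 0, is \<open>Q\<close>.\<close>

definition answers_within :: "com \<Rightarrow> nat list \<Rightarrow> bool \<Rightarrow> real \<Rightarrow> bool" where
  "answers_within P xs Q T \<longleftrightarrow>
     (\<exists>t R M. exec P (initial_state xs) t (R, M) \<and> (R 0 \<noteq> 0 \<longleftrightarrow> Q) \<and> real t \<le> T)"

text \<open>The total number of binary digits of the input; the number 0 has one digit.\<close>

definition input_size :: "nat list \<Rightarrow> nat" where
  "input_size xs = (\<Sum>x\<leftarrow>xs. max 1 (floorlog 2 x))"

text \<open>An instance with vertex set \<open>{..<n}\<close> is given by \<open>n\<close>, \<open>k\<close> and the adjacency matrix, row by row.\<close>

definition instance_encoding :: "nat \<Rightarrow> nat set set \<Rightarrow> nat \<Rightarrow> nat list" where
  "instance_encoding n E k =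
     n # k # [if {i, j} \<in> E then 1 else 0. i \<leftarrow> [0..<n], j \<leftarrow> [0..<n]]"

end

theory Submission
  imports Defs
begin

text \<open>Every edge of a split graph meets the clique, so a maximal matching with \<open>m\<close> edges witnesses a
  clique of size at least \<open>m\<close>, whose balanced bipartition cuts at least \<open>m (m - 1) / 4\<close> edges.
  If this is at least \<open>k\<close>, the answer is yes. Otherwise \<open>m \<le> 2 \<surd>k + 1\<close>, and the \<open>2 m\<close> matched
  vertices form a vertex cover: for each of its \<open>4\<^sup>m\<close> bipartitions the remaining
  vertices, being independent, are placed greedily. Neither the clique nor the split partition
  is ever computed.\<close>

section \<open>Weakest preconditions with elapsed time\<close>

text \<open>The ends of different matching edges are distinct, which is why \<open>m\<close> edges
  force \<open>m\<close> clique vertices although no clique is known to the program; maximality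
  makes the same ends meet every edge. A large \<open>m\<close> thus yields a cut, a small one
  bounds the number of colourings to be tried. The machine has no products, roots or powers, and
  this shapes the program. The number m (m - 1) / 2 is accumulated as the sum 0 + 1 + ... + (m - 1)
  and compared with 2 k. The adjacency matrix is read through a pointer that only moves down. The
  colours of the cover are themselves a binary counter in memory whose overflow ends the search, so
  the number of colourings is never computed.\<close>

definition wp :: "com \<Rightarrow> ((reg \<Rightarrow> nat) \<Rightarrow> (nat \<Rightarrow> nat) \<Rightarrow> nat \<Rightarrow> bool) \<Rightarrow>
    (reg \<Rightarrow> nat) \<Rightarrow> (nat \<Rightarrow> nat) \<Rightarrow> nat \<Rightarrow> bool" where
  "wp c Q R M u \<longleftrightarrow> (\<exists>t R' M'. exec c (R, M) t (R', M') \<and> Q R' M' (u + t))"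

lemma wpI: "exec c (R, M) t (R', M') \<Longrightarrow> Q R' M' (u + t) \<Longrightarrow> wp c Q R M u"
  unfolding wp_def by blast

lemma wpE:
  assumes "wp c Q R M u"
  obtains t R' M' where "exec c (R, M) t (R', M')" "Q R' M' (u + t)"
  using assms unfolding wp_def by blast

lemma wp_mono:
  assumes "wp c Q R M u" and "\<And>R' M' u'. Q R' M' u' \<Longrightarrow> Q' R' M' u'"
  shows "wp c Q' R M u"
  using assms unfolding wp_def by blast

text \<open>Determinism makes the run found the only run, so an equivalence holds and each
  instruction can be rewritten away. The clock \<open>u\<close> is absolute; sequencing therefore is
  mere nesting of \<open>wp\<close>.\<close>

lemma wp_exec:
  assumes "exec c (R, M) t (R', M')"
  shows "wp c Q R M u \<longleftrightarrow> Q R' M' (u + t)"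
  using assms exec_deterministic unfolding wp_def by blast

lemmas wp_basic [simp] =
  wp_exec[OF exec.Const] wp_exec[OF exec.Copy] wp_exec[OF exec.Add]
  wp_exec[OF exec.Sub] wp_exec[OF exec.Load] wp_exec[OF exec.Store]

inductive_cases exec_SeqE: "exec (Seq c d) s t s'"
inductive_cases exec_IfE: "exec (If x c d) (R, M) t s'"

lemma wp_Seq [simp]: "wp (Seq c d) Q R M u \<longleftrightarrow> wp c (wp d Q) R M u"
proof
  assume "wp (Seq c d) Q R M u"
  then obtain t R' M' where *: "exec (Seq c d) (R, M) t (R', M')" "Q R' M' (u + t)"
    by (rule wpE)
  from *(1) obtain t1 R1 M1 t2 where
    "exec c (R, M) t1 (R1, M1)" "exec d (R1, M1) t2 (R', M')" "t = t1 + t2"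
    by (rule exec_SeqE) (metis surj_pair)
  with *(2) show "wp c (wp d Q) R M u"
    by (intro wpI) (auto simp: add.assoc)
next
  assume "wp c (wp d Q) R M u"
  then obtain t1 R1 M1 where 1: "exec c (R, M) t1 (R1, M1)" "wp d Q R1 M1 (u + t1)"
    by (rule wpE)
  from 1(2) obtain t2 R2 M2 where 2: "exec d (R1, M1) t2 (R2, M2)" "Q R2 M2 (u + t1 + t2)"
    by (rule wpE)
  with Seq[OF 1(1) 2(1)] show "wp (Seq c d) Q R M u"
    by (intro wpI) (auto simp: add.assoc)
qed

lemma wp_If [simp]:
  "wp (If x c d) Q R M u \<longleftrightarrow> (if R x \<noteq> 0 then wp c Q R M (u + 1) else wp d Q R M (u + 1))"
proof
  assume "wp (If x c d) Q R M u"
  then obtain t R' M' where *: "exec (If x c d) (R, M) t (R', M')" "Q R' M' (u + t)"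
    by (rule wpE)
  from *(1) show "if R x \<noteq> 0 then wp c Q R M (u + 1) else wp d Q R M (u + 1)"
    by (rule exec_IfE) (use *(2) in \<open>auto intro: wpI simp: add.assoc\<close>)
next
  assume *: "if R x \<noteq> 0 then wp c Q R M (u + 1) else wp d Q R M (u + 1)"
  show "wp (If x c d) Q R M u"
  proof (cases "R x = 0")
    case True
    with * obtain t R' M' where 1: "exec d (R, M) t (R', M')" "Q R' M' (u + 1 + t)"
      by (auto elim: wpE)
    show ?thesis
      by (rule wpI, rule IfFalse[where R = R, OF True 1(1)]) (use 1(2) in simp)
  next
    case False
    with * obtain t R' M' where 1: "exec c (R, M) t (R', M')" "Q R' M' (u + 1 + t)"
      by (auto elim: wpE)
    show ?thesis
      by (rule wpI, rule IfTrue[where R = R, OF False 1(1)]) (use 1(2) in simp)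
  qed
qed

lemma wp_While:
  assumes "R x = 0 \<Longrightarrow> Q R M (u + 1)"
    and "R x \<noteq> 0 \<Longrightarrow> wp c (wp (While x c) Q) R M (u + 1)"
  shows "wp (While x c) Q R M u"
proof (cases "R x = 0")
  case True
  then show ?thesis using WhileFalse assms(1) by (intro wpI)
next
  case False
  with assms(2) have "wp c (wp (While x c) Q) R M (u + 1)"
    by simp
  then obtain t1 R1 M1 where 1: "exec c (R, M) t1 (R1, M1)" "wp (While x c) Q R1 M1 (u + 1 + t1)"
    by (rule wpE)
  from 1(2) obtain t2 R2 M2 where
    2: "exec (While x c) (R1, M1) t2 (R2, M2)" "Q R2 M2 (u + 1 + t1 + t2)"
    by (rule wpE)
  have "exec (While x c) (R, M) (1 + t1 + t2) (R2, M2)"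
    by (rule WhileTrue[where R = R, OF False 1(1) 2(1)])
  with 2(2) show ?thesis
    by (intro wpI) (auto simp: add.assoc)
qed

abbreviation Seq_infix (infixr ";;" 60) where "c ;; d \<equiv> Seq c d"

abbreviation (input) "rAns \<equiv> 0 :: reg"
abbreviation (input) "rOne \<equiv> 2 :: reg"
abbreviation (input) "rN \<equiv> 3 :: reg"
abbreviation (input) "rK \<equiv> 4 :: reg"
abbreviation (input) "rB \<equiv> 5 :: reg"
abbreviation (input) "rI \<equiv> 6 :: reg"
abbreviation (input) "rJ \<equiv> 7 :: reg"
abbreviation (input) "rP \<equiv> 8 :: reg"
abbreviation (input) "rX \<equiv> 9 :: reg"
abbreviation (input) "rY \<equiv> 10 :: reg"
abbreviation (input) "rC \<equiv> 11 :: reg"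
abbreviation (input) "rD \<equiv> 12 :: reg"
abbreviation (input) "rDegA \<equiv> 13 :: reg"
abbreviation (input) "rDegB \<equiv> 14 :: reg"
abbreviation (input) "rTot \<equiv> 15 :: reg"
abbreviation (input) "rPairs \<equiv> 16 :: reg"
abbreviation (input) "rAcc \<equiv> 17 :: reg"
abbreviation (input) "rRun \<equiv> 18 :: reg"

text \<open>Counting down makes the loop test a plain register test; the body sees the indices
  \<open>n - 1, \<dots>, 0\<close>.\<close>

definition For :: "reg \<Rightarrow> com \<Rightarrow> com" where
  "For x c = Copy x rN ;; While x (Sub x x rOne ;; c)"

abbreviation "Skip \<equiv> Copy rX rX"

text \<open>A round costs the test, the decrement and at most \<open>K\<close> steps of the body;
  the final 2 pays for the initial copy and the failing test. \<open>J i\<close> describes the state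
  when \<open>i\<close> rounds remain, and the body has to leave the counter as it found it.\<close>

lemma wp_For:
  assumes init: "R rN = N" "J N (R(x := N)) M"
    and one: "\<And>i R M. J i R M \<Longrightarrow> R rOne = 1"
    and body: "\<And>i R M u. \<lbrakk>i < N; J (Suc i) R M; R x = Suc i\<rbrakk> \<Longrightarrow>
      wp c (\<lambda>R' M' u'. J i R' M' \<and> R' x = i \<and> u' \<le> u + K) (R(x := i)) M u"
    and post: "\<And>R' M' u'. \<lbrakk>J 0 R' M'; R' x = 0; u' \<le> u + N * (K + 2) + 2\<rbrakk> \<Longrightarrow> Q R' M' u'"
  shows "wp (For x c) Q R M u"
proof -
  let ?W = "While x (Sub x x rOne ;; c)"
  have loop: "wp ?W Q R M v"
    if "J i R M" "R x = i" "i \<le> N" "v + i * (K + 2) \<le> u + N * (K + 2) + 1" for i R M v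
    using that
  proof (induction i arbitrary: R M v)
    case 0
    then show ?case by (intro wp_While) (auto intro: post)
  next
    case (Suc i)
    have "wp c (wp ?W Q) (R(x := i)) M (v + 2)"
      by (rule wp_mono, rule body[of i R M "v + 2"]) (use Suc in auto)
    then show ?case
      using Suc.prems(2) one[OF Suc.prems(1)]
      by (intro wp_While) (auto simp: numeral_2_eq_2)
  qed
  show ?thesis
    unfolding For_def using init by (auto intro: loop[of N])
qed

section \<open>Maximum cuts from the cuts of a vertex cover\<close>

text \<open>A colouring maps the vertices of the cover to their side, 1 or 2, and all other
  vertices to 0.\<close>

definition degree_to :: "nat \<Rightarrow> nat set set \<Rightarrow> (nat \<Rightarrow> nat) \<Rightarrow> nat \<Rightarrow> nat \<Rightarrow> nat" where
  "degree_to n E col c i = (\<Sum>j<n. of_bool ({i, j} \<in> E \<and> col j = c))"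

text \<open>The size of a best cut extending \<open>col\<close> if the coloured vertices cover all
  edges: an uncoloured vertex then has only coloured neighbours and takes the better side on its
  own. Edges inside the cover are counted at their end of colour 1 only, lest they count
  twice.\<close>

definition score :: "nat \<Rightarrow> nat set set \<Rightarrow> (nat \<Rightarrow> nat) \<Rightarrow> nat" where
  "score n E col = (\<Sum>i<n.
     if col i = 0 then max (degree_to n E col 1 i) (degree_to n E col 2 i)
     else if col i = 1 then degree_to n E col 2 i else 0)"

definition vertex_cover :: "'a set \<Rightarrow> 'a set set \<Rightarrow> bool" where
  "vertex_cover S E \<longleftrightarrow> (\<forall>u v. {u, v} \<in> E \<longrightarrow> u \<in> S \<or> v \<in> S)"

definition two_colouring :: "nat set \<Rightarrow> nat set \<Rightarrow> nat \<Rightarrow> nat" where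
  "two_colouring S A v = (if v \<notin> S then 0 else if v \<in> A then 1 else 2)"

lemma simple_graph_edge:
  assumes "simple_graph V E" "{u, v} \<in> E"
  shows "u \<in> V" "v \<in> V" "u \<noteq> v"
  using assms unfolding simple_graph_def nsets_def by (auto simp: subset_iff card_insert_if split: if_splits)

text \<open>Disjointness lets each cut edge be oriented from \<open>A\<close> to \<open>B\<close> in
  only one way.\<close>

lemma cut_size_pairs:
  assumes "finite A" "finite B" "A \<inter> B = {}"
  shows "cut_size E A B = card {(u, v) \<in> A \<times> B. {u, v} \<in> E}"
proof -
  have "{e \<in> E. \<exists>u\<in>A. \<exists>v\<in>B. e = {u, v}} = (\<lambda>(u, v). {u, v}) ` {(u, v) \<in> A \<times> B. {u, v} \<in> E}"
    by auto
  moreover have "inj_on (\<lambda>(u, v). {u, v}) {(u, v) \<in> A \<times> B. {u, v} \<in> E}"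
    using assms(3) by (auto simp: inj_on_def doubleton_eq_iff)
  ultimately show ?thesis
    unfolding cut_size_def by (simp add: card_image)
qed

lemma cut_size_sum:
  fixes n :: nat
  assumes "A \<subseteq> {..<n}"
  shows "cut_size E A ({..<n} - A) = (\<Sum>u<n. \<Sum>v<n. of_bool (u \<in> A \<and> v \<notin> A \<and> {u, v} \<in> E))"
proof -
  have "{(u, v) \<in> A \<times> ({..<n} - A). {u, v} \<in> E}
      = ({..<n} \<times> {..<n}) \<inter> {x. fst x \<in> A \<and> snd x \<notin> A \<and> {fst x, snd x} \<in> E}"
    using assms by auto
  moreover have "cut_size E A ({..<n} - A) = card {(u, v) \<in> A \<times> ({..<n} - A). {u, v} \<in> E}"
    by (intro cut_size_pairs) (auto intro: finite_subset[OF assms])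
  moreover have "card (({..<n} \<times> {..<n}) \<inter> {x. P x}) = (\<Sum>x\<in>{..<n} \<times> {..<n}. of_bool (P x))" for P
    by (simp add: sum_of_bool_eq)
  ultimately show ?thesis
    by (simp only: sum.cartesian_product case_prod_unfold)
qed

text \<open>An edge with one end outside the cover is charged to that end, an edge inside the cover
  to its end in \<open>A\<close>.\<close>

lemma cut_size_via_cover:
  assumes A: "A \<subseteq> {..<n}"
    and cover: "vertex_cover S E"
  defines "col \<equiv> two_colouring S A"
  shows "cut_size E A ({..<n} - A) = (\<Sum>i<n.
     if col i = 0 then if i \<in> A then degree_to n E col 2 i else degree_to n E col 1 i
     else if col i = 1 then degree_to n E col 2 i else 0)"
proof -
  let ?W = "\<lambda>u v. of_bool (u \<in> A \<and> v \<notin> A \<and> {u, v} \<in> E) :: nat"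
  have "(\<Sum>u<n. \<Sum>v<n. ?W u v)
      = (\<Sum>u<n. \<Sum>v<n. of_bool (v \<in> S) * ?W u v) + (\<Sum>u<n. \<Sum>v<n. of_bool (v \<notin> S) * ?W u v)"
    unfolding sum.distrib[symmetric] by (intro sum.cong) auto
  \<comment> \<open>Pairs whose end outside \<open>A\<close> also misses the cover are charged to
    that end; exchanging the sums makes the charged vertex the outer index in both parts.\<close>
  also have "(\<Sum>u<n. \<Sum>v<n. of_bool (v \<notin> S) * ?W u v) = (\<Sum>u<n. \<Sum>v<n. of_bool (u \<notin> S) * ?W v u)"
    by (rule sum.swap)
  finally have "cut_size E A ({..<n} - A)
      = (\<Sum>u<n. \<Sum>v<n. of_bool (v \<in> S) * ?W u v + of_bool (u \<notin> S) * ?W v u)"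
    unfolding cut_size_sum[OF A] sum.distrib[symmetric] .
  also have "\<dots> = (\<Sum>i<n.
     if col i = 0 then if i \<in> A then degree_to n E col 2 i else degree_to n E col 1 i
     else if col i = 1 then degree_to n E col 2 i else 0)"
  proof (intro sum.cong refl)
    fix u
    have [simp]: "{v, u} \<in> E \<longleftrightarrow> {u, v} \<in> E" for v
      by (simp add: insert_commute)
    have [dest]: "v \<in> S" if "{u, v} \<in> E" "u \<notin> S" for v
      using cover that unfolding vertex_cover_def by blast
    show "(\<Sum>v<n. of_bool (v \<in> S) * ?W u v + of_bool (u \<notin> S) * ?W v u)
      = (if col u = 0 then if u \<in> A then degree_to n E col 2 u else degree_to n E col 1 u
         else if col u = 1 then degree_to n E col 2 u else 0)"
      unfolding col_def two_colouring_def degree_to_def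
      by (auto intro!: sum.cong simp: of_bool_def)
  qed
  finally show ?thesis .
qed

text \<open>A cut restricts to a colouring of \<open>S\<close> whose score is at least its size;
  conversely, greedy placement of the other vertices attains the score. \<open>A\<close> may be any
  set, as only its trace on \<open>S\<close> is read.\<close>

lemma maxcut_iff_score:
  assumes S: "S \<subseteq> {..<n}"
    and cover: "vertex_cover S E"
  shows "maxcut {..<n} E k \<longleftrightarrow> (\<exists>A. k \<le> score n E (two_colouring S A))"
proof
  assume "maxcut {..<n} E k"
  then obtain A B where "A \<union> B = {..<n}" "A \<inter> B = {}" "k \<le> cut_size E A B"
    unfolding maxcut_def is_cut_def by blast
  moreover from this have "B = {..<n} - A" by blast
  ultimately have A: "A \<subseteq> {..<n}" "k \<le> cut_size E A ({..<n} - A)" by auto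
  note A(2)
  also have "cut_size E A ({..<n} - A) \<le> score n E (two_colouring S A)"
    unfolding cut_size_via_cover[OF A(1) cover] score_def by (intro sum_mono) auto
  finally show "\<exists>A. k \<le> score n E (two_colouring S A)" ..
next
  assume "\<exists>A. k \<le> score n E (two_colouring S A)"
  then obtain A where A: "k \<le> score n E (two_colouring S A)" ..
  let ?col = "two_colouring S A"
  \<comment> \<open>Greedy placement: an uncoloured vertex joins side 1 if it has at least as many
    neighbours of colour 2 as of colour 1.\<close>
  let ?A' = "(S \<inter> A) \<union> {i \<in> {..<n} - S. degree_to n E ?col 1 i \<le> degree_to n E ?col 2 i}"
  have col: "two_colouring S ?A' = ?col"
    unfolding two_colouring_def by auto
  have A': "?A' \<subseteq> {..<n}" using S by auto
  have "score n E ?col = cut_size E ?A' ({..<n} - ?A')"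
    unfolding cut_size_via_cover[OF A' cover] col score_def
    by (intro sum.cong refl) (auto simp: two_colouring_def max_def)
  with A A' show "maxcut {..<n} E k"
    unfolding maxcut_def is_cut_def by (intro exI[of _ ?A'] exI[of _ "{..<n} - ?A'"]) auto
qed

text \<open>Putting \<open>m div 2\<close> clique vertices on one side and everything else on the
  other cuts enough clique edges: \<open>4 * (h * (m - h))\<close> is m^2 or m^2 - 1. An inequality
  \<open>m \<le> card D\<close> suffices because a matching edge may have both ends in the
  clique.\<close>

lemma maxcut_clique:
  assumes "finite V" "D \<subseteq> V" "clique D E"
    and m: "m \<le> card D" and k: "4 * k \<le> m * (m - 1)"
  shows "maxcut V E k"
proof -
  define h where "h = m div 2"
  obtain A where A: "A \<subseteq> D" "card A = h"
    using m by (auto simp: h_def intro: obtain_subset_with_card_n[of h D])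
  have fin: "finite D" "finite A"
    using finite_subset[OF assms(2,1)] finite_subset[OF A(1)] by auto
  have "{u, v} \<in> E" if "u \<in> A" "v \<in> D - A" for u v
    using that A(1) assms(3) unfolding clique_def by (metis DiffE subsetD)
  then have "A \<times> (D - A) \<subseteq> {(u, v) \<in> A \<times> (V - A). {u, v} \<in> E}"
    using assms A by auto
  then have "card (A \<times> (D - A)) \<le> card {(u, v) \<in> A \<times> (V - A). {u, v} \<in> E}"
    using fin assms(1) by (intro card_mono finite_subset[of "{(u, v) \<in> A \<times> (V - A). {u, v} \<in> E}" "A \<times> V"]) auto
  also have "\<dots> = cut_size E A (V - A)"
    using fin assms(1) by (intro cut_size_pairs[symmetric]) auto
  also have "card (A \<times> (D - A)) = h * (card D - h)"
    using A fin by (simp add: card_cartesian_product card_Diff_subset)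
  finally have cut: "h * (card D - h) \<le> cut_size E A (V - A)" .
  have "m * (m - 1) \<le> 4 * (h * (m - h))"
  proof (cases "even m")
    case True
    then have "m = 2 * h" by (simp add: h_def)
    then show ?thesis by (simp add: algebra_simps)
  next
    case False
    then have "m = 2 * h + 1" by (simp add: h_def)
    then show ?thesis by (simp add: algebra_simps)
  qed
  then have "k \<le> h * (m - h)" using k by linarith
  also have "\<dots> \<le> h * (card D - h)" using m by (intro mult_mono) auto
  finally have "k \<le> cut_size E A (V - A)" using cut by simp
  then show ?thesis
    unfolding maxcut_def is_cut_def using A assms by (intro exI[of _ A] exI[of _ "V - A"]) auto
qed

section \<open>Enumerating the colourings of a set in binary\<close>

text \<open>The binary digits of \<open>t\<close> are spread over \<open>S\<close>, with digit 0 as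
  colour 1 and digit 1 as colour 2. The largest vertex gets the least significant digit, so a loop
  counting down meets the digits in the order of carry propagation.\<close>

definition colouring :: "nat \<Rightarrow> nat set \<Rightarrow> nat \<Rightarrow> nat \<Rightarrow> nat" where
  "colouring n S t v = (if v \<in> S then 1 + t div 2 ^ card (S \<inter> {Suc v..<n}) mod 2 else 0)"

lemma card_Int_atLeastLessThan:
  fixes i n :: nat
  assumes "i < n"
  shows "card (S \<inter> {i..<n}) = of_bool (i \<in> S) + card (S \<inter> {Suc i..<n})"
proof -
  have "{i..<n} = insert i {Suc i..<n}" using assms by auto
  then show ?thesis by simp
qed

lemma colouring_surj_from:
  assumes "i \<le> n"
  shows "\<exists>t < 2 ^ card (S \<inter> {i..<n}). \<forall>v\<in>{i..<n}. colouring n S t v = two_colouring S A v"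
  using assms
proof (induction rule: inc_induct)
  case base
  then show ?case by simp
next
  case (step i)
  define q where "q = card (S \<inter> {Suc i..<n})"
  from step obtain t where t: "t < 2 ^ q" "\<forall>v\<in>{Suc i..<n}. colouring n S t v = two_colouring S A v"
    unfolding q_def by blast
  \<comment> \<open>The digit of \<open>i\<close>, at position \<open>q\<close> above all digits
    already chosen.\<close>
  define b :: nat where "b = of_bool (i \<in> S \<and> i \<notin> A)"
  have "colouring n S (t + 2 ^ q * b) v = two_colouring S A v" if v: "v \<in> {i..<n}" for v
  proof (cases "v = i")
    case True
    have "(t + 2 ^ q * b) div 2 ^ q = b"
      using t(1) by simp
    then show ?thesis
      using True by (simp add: colouring_def two_colouring_def flip: q_def) (simp add: b_def)
  next
    case False
    with v have vn: "Suc i \<le> v" "v < n" by auto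
    have less: "card (S \<inter> {Suc v..<n}) < q" if "v \<in> S"
    proof -
      have "card (insert v (S \<inter> {Suc v..<n})) \<le> q"
        unfolding q_def by (rule card_mono) (use that vn in auto)
      then show ?thesis by simp
    qed
    \<comment> \<open>Vertices above \<open>i\<close> read digits at positions below
      \<open>q\<close>, which the new summand does not touch.\<close>
    then have "(t + 2 ^ q * b) div 2 ^ card (S \<inter> {Suc v..<n}) mod 2 = t div 2 ^ card (S \<inter> {Suc v..<n}) mod 2"
      if vS: "v \<in> S"
    proof -
      obtain d where d: "q = card (S \<inter> {Suc v..<n}) + Suc d"
        using less_imp_Suc_add[OF less[OF vS]] by auto
      have e: "t + 2 ^ q * b = t + 2 ^ card (S \<inter> {Suc v..<n}) * (2 * (2 ^ d * b))"
        unfolding d by (simp add: power_add)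
      show ?thesis unfolding e by simp
    qed
    then have "colouring n S (t + 2 ^ q * b) v = colouring n S t v"
      by (simp add: colouring_def)
    with t(2) vn show ?thesis by simp
  qed
  moreover have "t + 2 ^ q * b < 2 ^ card (S \<inter> {i..<n})"
    using t(1) step.hyps by (auto simp: card_Int_atLeastLessThan b_def simp flip: q_def)
  ultimately show ?case by blast
qed

lemma colouring_surj:
  assumes "S \<subseteq> {..<n}"
  shows "\<exists>t < 2 ^ card S. colouring n S t = two_colouring S A"
proof -
  obtain t where t: "t < 2 ^ card (S \<inter> {0..<n})"
    "\<forall>v\<in>{0..<n}. colouring n S t v = two_colouring S A v"
    using colouring_surj_from[of 0 n S A] by auto
  have "colouring n S t v = two_colouring S A v" for v
    using t(2) assms by (cases "v < n") (auto simp: colouring_def two_colouring_def)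
  with t(1) assms show ?thesis
    by (intro exI[of _ t]) (auto simp: lessThan_atLeast0 Int_absorb2)
qed

lemma colouring_eq_two_colouring:
  "colouring n S t = two_colouring S {v. colouring n S t v = 1}"
  unfolding colouring_def two_colouring_def by (auto simp: fun_eq_iff)

lemma maxcut_iff_colouring:
  assumes "S \<subseteq> {..<n}" "vertex_cover S E"
  shows "maxcut {..<n} E k \<longleftrightarrow> (\<exists>t < 2 ^ card S. k \<le> score n E (colouring n S t))"
  unfolding maxcut_iff_score[OF assms]
  using colouring_surj[OF assms(1)] colouring_eq_two_colouring by metis

text \<open>Binary increment: divisibility of \<open>Suc t\<close> by \<open>2 ^ q v\<close> says
  that the carry reaches the digit of \<open>v\<close>, \<open>3 - c\<close> flips this digit, and
  the carry moves on exactly if the digit was 1, that is colour 2.\<close>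

lemma colouring_Suc:
  fixes t n :: nat and S :: "nat set"
  defines "q \<equiv> \<lambda>v. card (S \<inter> {Suc v..<n})"
  assumes "v \<in> S"
  shows "colouring n S (Suc t) v =
    (if 2 ^ q v dvd Suc t then 3 - colouring n S t v else colouring n S t v)"
    and "2 ^ Suc (q v) dvd Suc t \<longleftrightarrow> 2 ^ q v dvd Suc t \<and> colouring n S t v = 2"
proof -
  have col: "colouring n S t v = 1 + t div 2 ^ q v mod 2" for t
    using assms(2) by (simp add: colouring_def q_def)
  have *: "Suc t div 2 ^ q v = (if 2 ^ q v dvd Suc t then Suc (t div 2 ^ q v) else t div 2 ^ q v)"
    by (simp add: div_Suc dvd_eq_mod_eq_0)
  show "colouring n S (Suc t) v =
    (if 2 ^ q v dvd Suc t then 3 - colouring n S t v else colouring n S t v)"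
  proof -
    have "1 + Suc x mod 2 = 3 - (1 + x mod 2)" for x :: nat by presburger
    then show ?thesis unfolding col * by (simp split: if_splits)
  qed
  show "2 ^ Suc (q v) dvd Suc t \<longleftrightarrow> 2 ^ q v dvd Suc t \<and> colouring n S t v = 2"
  proof (cases "2 ^ q v dvd Suc t")
    case True
    then have "Suc t = 2 ^ q v * Suc (t div 2 ^ q v)"
      using * by (metis dvd_mult_div_cancel)
    then have "2 ^ Suc (q v) dvd Suc t \<longleftrightarrow> 2 ^ q v * 2 dvd 2 ^ q v * Suc (t div 2 ^ q v)"
      by (simp add: mult.commute)
    also have "\<dots> \<longleftrightarrow> 2 dvd Suc (t div 2 ^ q v)"
      by (subst nat_mult_dvd_cancel1) auto
    finally show ?thesis using True unfolding col
      by (cases "even (t div 2 ^ q v)") (auto simp: odd_iff_mod_2_eq_one)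
  next
    case False
    then show ?thesis using dvd_trans[of "2 ^ q v" "2 ^ Suc (q v)"] by auto
  qed
qed

section \<open>The program\<close>

text \<open>The colours are stored behind the input, from address \<open>n\<^sup>2 + 2\<close> on. The pointer \<open>rP\<close>
  walks backwards through the adjacency matrix, since products of registers are not available.\<close>

definition setup_env :: com where
  "setup_env = Const rOne 1 ;; Load rN rAns ;; Load rK rOne ;; Const rB 2 ;; For rI (Add rB rB rN)"

text \<open>Greedy matching: an edge is taken if the marks of both its ends are 0.
  \<open>rAcc\<close> is increased before \<open>rPairs\<close>, so it ends as 0 + 1 + ... + (m -
  1).\<close>

definition match_edges :: com where
  "match_edges = Copy rP rB ;;
    For rI (For rJ (Sub rP rP rOne ;; Load rC rP ;;
      If rC
        (Add rX rB rI ;; Add rY rB rJ ;; Load rC rX ;; Load rD rY ;; Add rC rC rD ;;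
         If rC Skip
           (Store rX rOne ;; Store rY rOne ;; Add rAcc rAcc rPairs ;; Add rPairs rPairs rOne))
        Skip))"

text \<open>Truncated subtraction yields the maximum: \<open>rDegA\<close> plus
  \<open>rDegB - rDegA\<close>. Colours 1 and 2 are told apart by subtracting 1.\<close>

definition eval_score :: com where
  "eval_score = Const rTot 0 ;; Copy rP rB ;;
    For rI (Const rDegA 0 ;; Const rDegB 0 ;;
      For rJ (Sub rP rP rOne ;; Load rC rP ;;
        If rC
          (Add rX rB rJ ;; Load rC rX ;;
           If rC (Sub rC rC rOne ;; If rC (Add rDegB rDegB rOne) (Add rDegA rDegA rOne)) Skip)
          Skip) ;;
      Add rX rB rI ;; Load rC rX ;;
      If rC (Sub rC rC rOne ;; If rC Skip (Add rTot rTot rDegB))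
        (Add rTot rTot rDegA ;; Sub rDegB rDegB rDegA ;; Add rTot rTot rDegB))"

text \<open>Here \<open>rRun\<close> is the carry bit.\<close>

definition next_colouring :: com where
  "next_colouring = Const rRun 1 ;;
    For rI (If rRun
      (Add rX rB rI ;; Load rC rX ;;
       If rC
         (Sub rC rC rOne ;;
          If rC (Store rX rOne) (Const rC 2 ;; Store rX rC ;; Const rRun 0))
         Skip)
      Skip)"

text \<open>\<open>rTot + 1 - rK\<close> is nonzero iff the score reaches \<open>k\<close>. The
  carry left by \<open>next_colouring\<close> signals overflow; its negation is the loop
  condition.\<close>

definition search :: com where
  "search = Const rRun 1 ;;
    While rRun
      (eval_score ;; Add rC rTot rOne ;; Sub rC rC rK ;; If rC (Const rAns 1) Skip ;;
       next_colouring ;; Sub rRun rOne rRun)"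

text \<open>With \<open>rAcc\<close> equal to m (m - 1) / 2, the tested value is nonzero iff 4 k
  \<le> m (m - 1), the hypothesis of \<open>maxcut_clique\<close>.\<close>

definition decide_maxcut :: com where
  "decide_maxcut = setup_env ;; match_edges ;;
    Add rC rAcc rOne ;; Sub rC rC rK ;; Sub rC rC rK ;; If rC (Const rAns 1) search"

section \<open>Memory layout and the set-up phase\<close>

definition env :: "nat \<Rightarrow> nat \<Rightarrow> (reg \<Rightarrow> nat) \<Rightarrow> bool" where
  "env n k R \<longleftrightarrow> R rOne = 1 \<and> R rN = n \<and> R rK = k \<and> R rB = 2 + n * n"

definition layout :: "nat \<Rightarrow> nat set set \<Rightarrow> (nat \<Rightarrow> nat) \<Rightarrow> (nat \<Rightarrow> nat) \<Rightarrow> bool" where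
  "layout n E M col \<longleftrightarrow>
     (\<forall>i<n. \<forall>j<n. M (2 + i * n + j) = of_bool ({i, j} \<in> E)) \<and>
     (\<forall>v<n. M (2 + n * n + v) = col v)"

lemma matrix_index_less:
  fixes i j n :: nat
  assumes "i < n" "j < n"
  shows "i * n + j < n * n"
proof -
  have "i * n + j < Suc i * n" using assms by simp
  also have "\<dots> \<le> n * n" using assms by (intro mult_right_mono) auto
  finally show ?thesis .
qed

lemma matrix_index_inj:
  fixes i j n :: nat
  assumes "j < n" "j' < n" "i * n + j = i' * n + j'"
  shows "i = i'" "j = j'"
proof -
  have "(i * n + j) div n = i" "(i' * n + j') div n = i'" using assms(1,2) by auto
  with assms(3) show "i = i'" by metis
  with assms show "j = j'" by simp
qed

lemma layout_adj: "layout n E M col \<Longrightarrow> i < n \<Longrightarrow> j < n \<Longrightarrow> M (Suc (Suc (i * n + j))) = of_bool ({i, j} \<in> E)"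
  and layout_col: "layout n E M col \<Longrightarrow> v < n \<Longrightarrow> M (Suc (Suc (n * n + v))) = col v"
  unfolding layout_def by auto

text \<open>Colour addresses lie beyond all matrix addresses, so recolouring keeps the matrix
  intact.\<close>

lemma layout_upd:
  assumes "layout n E M col" "v < n"
  shows "layout n E (M(Suc (Suc (n * n + v)) := c)) (col(v := c))"
proof -
  have "i * n + j \<noteq> n * n + v" if "i < n" "j < n" for i j
    using matrix_index_less[OF that] by simp
  with assms show ?thesis unfolding layout_def by auto
qed

text \<open>\<open>rAns\<close> and \<open>rOne\<close> hold 0 and 1 when they serve as the
  addresses of \<open>n\<close> and \<open>k\<close>; n rounds of adding \<open>n\<close> to 2
  replace a product.\<close>

lemma wp_setup_env:
  assumes "\<And>y. R y = 0" and n: "M 0 = n" and k: "M 1 = k"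
    and post: "\<And>R' u'. \<lbrakk>env n k R'; R' rAns = 0; R' rAcc = 0; R' rPairs = 0; u' \<le> u + (3 * n + 6)\<rbrakk> \<Longrightarrow>
      Q R' M u'"
  shows "wp setup_env Q R M u"
proof -
  let ?J = "\<lambda>i R' M'. M' = M \<and> R' rOne = 1 \<and> R' rN = n \<and> R' rK = k \<and> R' rB + i * n = 2 + n * n \<and>
     R' rAns = 0 \<and> R' rAcc = 0 \<and> R' rPairs = 0"
  show ?thesis
    unfolding setup_env_def
    apply simp
    apply (rule wp_For[where J = ?J and N = n and K = 1])
    using assms(1) n k apply simp
    using assms(1) n k apply simp
      apply simp
     apply simp
    using assms(1) n k by (auto intro!: post simp: env_def)
qed

section \<open>Correctness of the greedy matching\<close>

text \<open>The bound on \<open>card (S \<inter> C)\<close> holds because every edge of a split graph meets the clique.\<close>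

definition partial_cover :: "nat \<Rightarrow> nat set set \<Rightarrow> nat set \<Rightarrow> nat \<Rightarrow> nat set \<Rightarrow> nat \<Rightarrow> bool" where
  "partial_cover n E C p S m \<longleftrightarrow> S \<subseteq> {..<n} \<and> card S = 2 * m \<and> m \<le> card (S \<inter> C) \<and>
     (\<forall>u<n. \<forall>v<n. p \<le> u * n + v \<longrightarrow> {u, v} \<in> E \<longrightarrow> u \<in> S \<or> v \<in> S)"

text \<open>Matrix entries from address \<open>p\<close> on have been scanned. Lowering
  \<open>p\<close> by one adds only the pair \<open>(i, j)\<close>, since the index determines the
  pair.\<close>

lemma partial_cover_skip:
  assumes "partial_cover n E C (Suc (i * n + j)) S m" "i < n" "j < n"
    and "{i, j} \<in> E \<Longrightarrow> i \<in> S \<or> j \<in> S"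
  shows "partial_cover n E C (i * n + j) S m"
  using assms matrix_index_inj[of _ n j] unfolding partial_cover_def
  by (metis Suc_leI le_neq_implies_less)

lemma partial_cover_extend:
  assumes S: "partial_cover n E C (Suc (i * n + j)) S m" and ij: "i < n" "j < n"
    and "i \<noteq> j" "i \<in> C \<or> j \<in> C" "i \<notin> S" "j \<notin> S"
  shows "partial_cover n E C (i * n + j) (insert i (insert j S)) (Suc m)"
proof (rule partial_cover_skip[OF _ ij])
  have fin: "finite S"
    using S finite_subset unfolding partial_cover_def by blast
  moreover have "Suc (card (S \<inter> C)) \<le> card (insert i (insert j S) \<inter> C)"
  proof -
    obtain x where x: "x \<in> {i, j}" "x \<in> C" using assms by blast
    have "card (insert x (S \<inter> C)) \<le> card (insert i (insert j S) \<inter> C)"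
      using x fin by (intro card_mono) auto
    with x fin assms show ?thesis by auto
  qed
  ultimately show "partial_cover n E C (Suc (i * n + j)) (insert i (insert j S)) (Suc m)"
    using assms unfolding partial_cover_def by auto
qed simp

text \<open>The equation for \<open>rAcc\<close> expresses m (m - 1) / 2 without division or
  subtraction.\<close>

definition matched :: "nat \<Rightarrow> nat \<Rightarrow> nat set set \<Rightarrow> nat set \<Rightarrow> nat \<Rightarrow> (reg \<Rightarrow> nat) \<Rightarrow> (nat \<Rightarrow> nat) \<Rightarrow> bool" where
  "matched n k E C p R M \<longleftrightarrow> env n k R \<and> R rAns = 0 \<and> R rP = 2 + p \<and>
     2 * R rAcc + R rPairs = R rPairs * R rPairs \<and>
     (\<exists>S. layout n E M (\<lambda>v. of_bool (v \<in> S)) \<and> partial_cover n E C p S (R rPairs))"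

lemma wp_match_edges:
  assumes "simple_graph {..<n} E" "independent ({..<n} - C) E"
    and "env n k R" "R rAns = 0" "R rAcc = 0" "R rPairs = 0" "layout n E M (\<lambda>_. 0)"
    and post: "\<And>R' M' u'. \<lbrakk>matched n k E C 0 R' M'; u' \<le> u + (15 * (n * n) + 4 * n + 3)\<rbrakk> \<Longrightarrow> Q R' M' u'"
  shows "wp match_edges Q R M u"
proof -
  let ?W = "Sub rP rP rOne ;; Load rC rP ;;
      If rC
        (Add rX rB rI ;; Add rY rB rJ ;; Load rC rX ;; Load rD rY ;; Add rC rC rD ;;
         If rC Skip
           (Store rX rOne ;; Store rY rOne ;; Add rAcc rAcc rPairs ;; Add rPairs rPairs rOne))
        Skip"
  have body: "wp ?W (\<lambda>R' M' u'. (matched n k E C (i * n + j) R' M' \<and> R' rI = i) \<and> R' rJ = j \<and> u' \<le> u + 13)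
      (R(rJ := j)) M u"
    if ij: "i < n" "j < n" and st: "matched n k E C (i * n + Suc j) R M" "R rI = i" for i j R M u
  proof -
    obtain S where S: "layout n E M (\<lambda>v. of_bool (v \<in> S))" "partial_cover n E C (Suc (i * n + j)) S (R rPairs)"
      using st(1) by (auto simp: matched_def)
    have R: "R rOne = 1" "R rN = n" "R rK = k" "R rB = 2 + n * n" "R rAns = 0" "R rP = 3 + i * n + j"
      "2 * R rAcc + R rPairs = R rPairs * R rPairs"
      using st(1) by (auto simp: matched_def env_def)
    note lay = layout_adj[OF S(1) ij] layout_col[OF S(1) ij(1)] layout_col[OF S(1) ij(2)]
    \<comment> \<open>The split structure enters here: independence outside \<open>C\<close> puts an
      end of every edge into \<open>C\<close>. Absence of loops makes the two new vertices
      distinct.\<close>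
    have edge: "i \<noteq> j" "i \<in> C \<or> j \<in> C" if "{i, j} \<in> E"
      using simple_graph_edge[OF assms(1) that] assms(2) that unfolding independent_def by auto
    have skip: "\<exists>S. layout n E M (\<lambda>v. of_bool (v \<in> S)) \<and> partial_cover n E C (i * n + j) S (R rPairs)"
      if "{i, j} \<in> E \<Longrightarrow> i \<in> S \<or> j \<in> S"
      using S partial_cover_skip[OF S(2) ij that] by blast
    have extend: "\<exists>S'. layout n E (M(Suc (Suc (n * n + i)) := Suc 0, Suc (Suc (n * n + j)) := Suc 0))
        (\<lambda>v. of_bool (v \<in> S')) \<and> partial_cover n E C (i * n + j) S' (Suc (R rPairs))"
      if E: "{i, j} \<in> E" and new: "i \<notin> S" "j \<notin> S"
    proof (intro exI conjI)
      have "(\<lambda>v. of_bool (v \<in> insert i (insert j S))) = (\<lambda>v. of_bool (v \<in> S))(i := Suc 0, j := Suc 0)"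
        by auto
      then show "layout n E (M(Suc (Suc (n * n + i)) := Suc 0, Suc (Suc (n * n + j)) := Suc 0))
        (\<lambda>v. of_bool (v \<in> insert i (insert j S)))"
        using layout_upd[OF layout_upd[OF S(1) ij(1)] ij(2)] by metis
      show "partial_cover n E C (i * n + j) (insert i (insert j S)) (Suc (R rPairs))"
        using partial_cover_extend[OF S(2) ij edge[OF E] new] .
    qed
    consider "{i, j} \<notin> E" | "{i, j} \<in> E" "i \<in> S \<or> j \<in> S" | "{i, j} \<in> E" "i \<notin> S" "j \<notin> S"
      by blast
    then show ?thesis
    proof cases
      case 1
      with skip show ?thesis
        by (simp add: matched_def env_def R lay st(2))
    next
      case 2
      with skip show ?thesis
        by (simp add: matched_def env_def R lay st(2))
    next
      case 3
      with extend R(7) show ?thesis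
        by (simp add: matched_def env_def R(1-6) lay st(2))
    qed
  qed
  show ?thesis
    unfolding match_edges_def
    apply simp
    apply (rule wp_For[where J = "\<lambda>i. matched n k E C (i * n)" and N = n and K = "15 * n + 2"])
    subgoal using assms by (simp add: env_def)
    subgoal using assms by (auto simp: matched_def env_def partial_cover_def intro!: exI[of _ "{}"])
       (use matrix_index_less in fastforce)
    subgoal by (simp add: matched_def env_def)
    subgoal for i R M u
      apply (rule wp_For[where J = "\<lambda>j R M. matched n k E C (i * n + j) R M \<and> R rI = i" and N = n and K = 13])
      subgoal by (simp add: matched_def env_def)
      subgoal by (simp add: matched_def env_def add.commute)
      subgoal by (simp add: matched_def env_def)
      subgoal using body by blast
      subgoal by (simp add: algebra_simps)
      done
    subgoal by (rule post) (auto simp: algebra_simps)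
    done
qed

section \<open>Correctness of the search over all colourings\<close>

lemma colouring_le_2: "colouring n S t v \<le> 2"
proof -
  have "x mod 2 \<le> 1" for x :: nat by presburger
  then show ?thesis by (simp add: colouring_def)
qed

lemma wp_eval_score:
  assumes env: "env n k R" and lay: "layout n E M col" and col: "\<And>v. v < n \<Longrightarrow> col v \<le> 2"
    and post: "\<And>R' u'. \<lbrakk>env n k R'; R' rAns = R rAns; R' rTot = score n E col;
        u' \<le> u + (11 * (n * n) + 12 * n + 4)\<rbrakk> \<Longrightarrow> Q R' M u'"
  shows "wp eval_score Q R M u"
proof -
  let ?d = "\<lambda>c i j. \<Sum>l\<in>{j..<n}. of_bool ({i, l} \<in> E \<and> col l = c) :: nat"
  let ?f = "\<lambda>i. if col i = 0 then max (degree_to n E col 1 i) (degree_to n E col 2 i)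
     else if col i = 1 then degree_to n E col 2 i else 0"
  define outer where "outer i R' M' \<longleftrightarrow> M' = M \<and> env n k R' \<and> R' rAns = R rAns \<and>
      R' rP = 2 + i * n \<and> R' rTot = (\<Sum>l\<in>{i..<n}. ?f l)" for i R' M'
  define inner where "inner i j R' M' \<longleftrightarrow> M' = M \<and> env n k R' \<and> R' rAns = R rAns \<and>
      R' rP = 2 + i * n + j \<and> R' rTot = (\<Sum>l\<in>{Suc i..<n}. ?f l) \<and> R' rI = i \<and>
      R' rDegA = ?d 1 i j \<and> R' rDegB = ?d 2 i j" for i j R' M'
  let ?W = "Sub rP rP rOne ;; Load rC rP ;;
        If rC
          (Add rX rB rJ ;; Load rC rX ;;
           If rC (Sub rC rC rOne ;; If rC (Add rDegB rDegB rOne) (Add rDegA rDegA rOne)) Skip)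
          Skip"
  have body: "wp ?W (\<lambda>R' M' u'. inner i j R' M' \<and> R' rJ = j \<and> u' \<le> u + 9) (R(rJ := j)) M u"
    if ij: "i < n" "j < n" and st: "inner i (Suc j) R M" for i j R M u
  proof -
    have "col j = 0 \<or> col j = 1 \<or> col j = 2" using col[OF ij(2)] by auto
    moreover have d: "?d c i j = of_bool ({i, j} \<in> E \<and> col j = c) + ?d c i (Suc j)" for c
      by (rule sum.atLeast_Suc_lessThan[OF ij(2)])
    ultimately show ?thesis
      using st layout_adj[OF lay ij] layout_col[OF lay ij(2)]
      unfolding inner_def d by (cases "{i, j} \<in> E"; elim disjE) (simp_all add: env_def)
  qed
  let ?T = "Add rX rB rI ;; Load rC rX ;;
      If rC (Sub rC rC rOne ;; If rC Skip (Add rTot rTot rDegB))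
        (Add rTot rTot rDegA ;; Sub rDegB rDegB rDegA ;; Add rTot rTot rDegB)"
  have tail: "wp ?T (\<lambda>R' M' u'. outer i R' M' \<and> R' rI = i \<and> u' \<le> u + 6) R' M' u"
    if i: "i < n" and st: "inner i 0 R' M'" for i R' M' u
  proof -
    have "col i = 0 \<or> col i = 1 \<or> col i = 2" using col[OF i] by auto
    moreover have "(\<Sum>l\<in>{i..<n}. ?f l) = ?f i + (\<Sum>l\<in>{Suc i..<n}. ?f l)"
      by (rule sum.atLeast_Suc_lessThan[OF i])
    moreover have "?d c i 0 = degree_to n E col c i" for c
      by (simp add: degree_to_def lessThan_atLeast0)
    ultimately show ?thesis
      using st layout_col[OF lay i]
      unfolding inner_def outer_def by (elim disjE) (simp_all add: env_def)
  qed
  show ?thesis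
    unfolding eval_score_def
    apply simp
    apply (rule wp_For[where J = outer and N = n and K = "11 * n + 10"])
    subgoal using env by (simp add: env_def)
    subgoal using env by (simp add: outer_def env_def)
    subgoal by (simp add: outer_def env_def)
    subgoal for i R M u
      apply simp
      apply (rule wp_For[where J = "inner i" and N = n and K = 9])
      subgoal by (simp add: outer_def env_def)
      subgoal by (simp add: outer_def inner_def env_def)
      subgoal by (simp add: inner_def env_def)
      subgoal by (rule body)
      subgoal for R' M' u'
        by (rule wp_mono[OF tail]) (auto simp: algebra_simps)
      done
    subgoal for R' M' u'
      using post[of R' u'] by (auto simp: outer_def score_def lessThan_atLeast0 algebra_simps)
    done
qed

text \<open>Midway, vertices from \<open>i\<close> on already show \<open>Suc t\<close> and the
  smaller ones still \<open>t\<close>; \<open>rRun\<close> tells whether the carry leaves the digits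
  of \<open>S \<inter> {i..<n}\<close>. At \<open>i = n\<close> there are no digits and the carry is
  1; at \<open>i = 0\<close> it is the overflow.\<close>

lemma wp_next_colouring:
  assumes env: "env n k R" and lay: "layout n E M (colouring n S t)" and S: "S \<subseteq> {..<n}"
    and post: "\<And>R' M' u'. \<lbrakk>env n k R'; R' rAns = R rAns; layout n E M' (colouring n S (Suc t));
        R' rRun = of_bool (2 ^ card S dvd Suc t); u' \<le> u + (11 * n + 3)\<rbrakk> \<Longrightarrow> Q R' M' u'"
  shows "wp next_colouring Q R M u"
proof -
  define new where "new i v = colouring n S (if i \<le> v then Suc t else t) v" for i v
  define J where "J i R' M' \<longleftrightarrow> env n k R' \<and> R' rAns = R rAns \<and> layout n E M' (new i) \<and>
    R' rRun = of_bool (2 ^ card (S \<inter> {i..<n}) dvd Suc t)" for i R' M'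
  have new_n: "layout n E M (new n)"
    using lay by (simp add: layout_def new_def)
  have new_0: "new 0 = colouring n S (Suc t)"
    by (auto simp: new_def)
  have new_Suc: "new i = (new (Suc i))(i := colouring n S (Suc t) i)" for i
    by (auto simp: new_def fun_eq_iff)
  let ?W = "If rRun
      (Add rX rB rI ;; Load rC rX ;;
       If rC
         (Sub rC rC rOne ;;
          If rC (Store rX rOne) (Const rC 2 ;; Store rX rC ;; Const rRun 0))
         Skip)
      Skip"
  have body: "wp ?W (\<lambda>R' M' u'. J i R' M' \<and> R' rI = i \<and> u' \<le> u + 9) (R(rI := i)) M u"
    if i: "i < n" and st: "J (Suc i) R M" for i R M u
  proof -
    have lay: "layout n E M (new (Suc i))" using st by (simp add: J_def)
    have M: "M (Suc (Suc (n * n + i))) = colouring n S t i"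
      using layout_col[OF lay i] by (simp add: new_def)
    note upd = layout_upd[OF lay i, of "colouring n S (Suc t) i", folded new_Suc]
    have same: "new i = new (Suc i)" if "colouring n S (Suc t) i = colouring n S t i"
      using that by (auto simp: new_def fun_eq_iff le_Suc_eq not_less_eq_eq)
    note card = card_Int_atLeastLessThan[OF i, of S]
    show ?thesis
    proof (cases "i \<in> S")
      case False
      then have "colouring n S (Suc t) i = 0" "colouring n S t i = 0"
        by (simp_all add: colouring_def)
      with same st lay M card False show ?thesis
        by (auto simp: J_def env_def)
    next
      case True
      note c = colouring_Suc[OF True, of n t]
      have "colouring n S t i = 1 \<or> colouring n S t i = 2"
        using True by (auto simp: colouring_def)
      then show ?thesis
        using c same st lay M card True upd by (auto simp: J_def env_def)
    qed
  qed
  show ?thesis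
    unfolding next_colouring_def
    apply simp
    apply (rule wp_For[where J = J and N = n and K = 9])
    subgoal using env by (simp add: env_def)
    subgoal using env new_n by (simp add: J_def env_def)
    subgoal by (simp add: J_def env_def)
    subgoal by (rule body)
    subgoal using S by (intro post) (auto simp: J_def new_0 lessThan_atLeast0 Int_absorb2)
    done
qed

lemma wp_search:
  assumes env: "env n k R" and ans: "R rAns = 0"
    and lay: "layout n E M (colouring n S 0)" and S: "S \<subseteq> {..<n}"
    and post: "\<And>R' M' u'. \<lbrakk>R' rAns \<noteq> 0 \<longleftrightarrow> (\<exists>t < 2 ^ card S. k \<le> score n E (colouring n S t));
        u' \<le> u + 2 ^ card S * (11 * (n * n) + 23 * n + 15) + 2\<rbrakk> \<Longrightarrow> Q R' M' u'"
  shows "wp search Q R M u"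
proof -
  let ?K = "11 * (n * n) + 23 * n + 15"
  let ?N = "2 ^ card S :: nat"
  define body where "body = (eval_score ;; Add rC rTot rOne ;; Sub rC rC rK ;;
       If rC (Const rAns 1) Skip ;; next_colouring ;; Sub rRun rOne rRun)"
  have wp_body: "wp body P R M u = wp (eval_score ;; Add rC rTot rOne ;; Sub rC rC rK ;;
       If rC (Const rAns 1) Skip ;; next_colouring ;; Sub rRun rOne rRun) P R M u" for P R M u
    by (simp only: body_def)
  have loop: "wp (While rRun body) Q R M v"
    if "env n k R" "layout n E M (colouring n S t)" "R rRun = of_bool (t < ?N)" "t \<le> ?N"
      "R rAns \<noteq> 0 \<longleftrightarrow> (\<exists>s < t. k \<le> score n E (colouring n S s))"
      "v \<le> u + 1 + t * ?K" for R M v t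
    using that
  proof (induction "?N - t" arbitrary: R M v t)
    case 0
    then have "t = ?N" by simp
    with 0 show ?case by (intro wp_While) (auto intro!: post)
  next
    case (Suc d)
    then have t: "t < ?N" by simp
    \<comment> \<open>As \<open>Suc t\<close> is at most \<open>?N\<close>, overflow occurs only
      after the last colouring.\<close>
    then have dvd: "?N dvd Suc t \<longleftrightarrow> \<not> Suc t < ?N"
      by (metis Suc_leI dvd_imp_le dvd_refl le_neq_implies_less leD zero_less_Suc)
    have ex: "(\<exists>s < Suc t. k \<le> score n E (colouring n S s)) \<longleftrightarrow>
        R rAns \<noteq> 0 \<or> k \<le> score n E (colouring n S t)"
      using Suc.prems(5) less_Suc_eq by auto
    show ?case
    proof (rule wp_While)
      show "Q R M (v + 1)" if "R rRun = 0" using that t Suc.prems(3) by simp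
      show "wp body (wp (While rRun body) Q) R M (v + 1)"
        apply (simp add: wp_body)
        apply (rule wp_eval_score[OF Suc.prems(1,2)])
        subgoal by (rule colouring_le_2)
        subgoal premises p for R' u'
        proof -
          have continue: "wp next_colouring (wp (Sub rRun rOne rRun) (wp (While rRun body) Q)) R2 M w"
            if R2: "env n k R2" "R2 rAns \<noteq> 0 \<longleftrightarrow> (\<exists>s < Suc t. k \<le> score n E (colouring n S s))"
              and w: "w \<le> v + (11 * (n * n) + 12 * n + 9)" for R2 w
            apply (rule wp_next_colouring[OF R2(1) Suc.prems(2) S])
            apply (subst wp_basic)
            apply (rule Suc.hyps(1)[of "Suc t"])
            using Suc.hyps(2) Suc.prems(6) R2 w t dvd by (auto simp: env_def)
          have R': "R' rOne = 1" "R' rK = k" "env n k (R'(rC := a, rX := b))"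
            "env n k (R'(rC := a, rAns := b))" for a b
            using p(1) by (simp_all add: env_def)
          show ?thesis
            using p(4) ex by (cases "k \<le> score n E (colouring n S t)")
              (auto simp: p(2,3) R' intro!: continue)
        qed
        done
    qed
  qed
  show ?thesis
    unfolding search_def body_def[symmetric]
    using assms by (auto intro!: loop[of _ _ 0] simp: env_def)
qed

section \<open>The whole program\<close>

lemma wp_decide_maxcut:
  assumes split: "split_graph {..<n} E"
    and R: "\<And>y. R y = 0" and M: "M 0 = n" "M 1 = k" and lay: "layout n E M (\<lambda>_. 0)"
  shows "wp decide_maxcut (\<lambda>R' M' u'. (R' rAns \<noteq> 0 \<longleftrightarrow> maxcut {..<n} E k) \<and>
      (\<exists>m. m * m \<le> m + 4 * k \<and> u' \<le> 4 ^ m * (26 * (n * n) + 30 * n + 30))) R M 0"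
proof -
  obtain C I where CI: "C \<union> I = {..<n}" "C \<inter> I = {}" "clique C E" "independent I E"
    and simple: "simple_graph {..<n} E"
    using split unfolding split_graph_def by blast
  have "I = {..<n} - C" using CI by blast
  with CI have indep: "independent ({..<n} - C) E" by simp
  let ?Q = "\<lambda>R' M' u'. (R' rAns \<noteq> 0 \<longleftrightarrow> maxcut {..<n} E k) \<and>
      (\<exists>m. m * m \<le> m + 4 * k \<and> u' \<le> 4 ^ m * (26 * (n * n) + 30 * n + 30))"
  have final: "wp (If rC (Const rAns 1) search) ?Q (R(rC := Suc (R rAcc) - k - k)) M u"
    if st: "matched n k E C 0 R M" and u: "u \<le> 15 * (n * n) + 7 * n + 12" for R M u
  proof -
    from st obtain S where S: "layout n E M (\<lambda>v. of_bool (v \<in> S))" "partial_cover n E C 0 S (R rPairs)"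
      and acc: "2 * R rAcc + R rPairs = R rPairs * R rPairs"
      and env: "env n k R" and ans: "R rAns = 0"
      unfolding matched_def by blast
    let ?m = "R rPairs"
    have sub: "S \<subseteq> {..<n}" and card: "card S = 2 * ?m" and cl: "?m \<le> card (S \<inter> C)"
      using S(2) unfolding partial_cover_def by auto
    have cover: "vertex_cover S E"
      using S(2) simple_graph_edge[OF simple] unfolding partial_cover_def vertex_cover_def by auto
    show ?thesis
    proof (cases "2 * k \<le> R rAcc")
      case True
      have "?m * (?m - 1) = 2 * R rAcc" using acc by (simp add: diff_mult_distrib2)
      with True have "4 * k \<le> ?m * (?m - 1)" by simp
      then have "maxcut {..<n} E k"
        using maxcut_clique[of "{..<n}" "S \<inter> C" E ?m k] sub cl CI(3) by (auto simp: clique_def)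
      then show ?thesis
        \<comment> \<open>Nothing is searched here, so \<open>m = 0\<close> witnesses the time
          bound.\<close>
        using True u by (auto intro!: exI[of _ 0])
    next
      case False
      \<comment> \<open>The marks left by the matching already are colouring number 0, hence the
        search needs no initialisation.\<close>
      have "(\<lambda>v. of_bool (v \<in> S)) = colouring n S 0"
        by (auto simp: colouring_def)
      with S(1) have lay0: "layout n E M (colouring n S 0)" by simp
      have "wp search ?Q (R(rC := 0)) M (u + 1)"
      proof (rule wp_search[OF _ _ lay0 sub])
        show "env n k (R(rC := 0))" using env by (simp add: env_def)
        show "(R(rC := 0)) rAns = 0" using ans by simp
        fix R' :: "reg \<Rightarrow> nat" and M' :: "nat \<Rightarrow> nat" and u'
        assume R': "R' rAns \<noteq> 0 \<longleftrightarrow> (\<exists>t < 2 ^ card S. k \<le> score n E (colouring n S t))"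
          and u': "u' \<le> u + 1 + 2 ^ card S * (11 * (n * n) + 23 * n + 15) + 2"
        \<comment> \<open>Multiplying the time spent before the search by \<open>4 ^ ?m\<close> lets
          its coefficients 15, 7, 15 be added to 11, 23, 15 of one search round.\<close>
        have "u + 3 \<le> 4 ^ ?m * (15 * (n * n) + 7 * n + 15)"
          using u by (intro order_trans[OF _ mult_right_mono[of 1 "4 ^ ?m"]]) auto
        moreover have "(2::nat) ^ card S = 4 ^ ?m"
          by (simp add: card power_mult)
        ultimately have "u' \<le> 4 ^ ?m * (26 * (n * n) + 30 * n + 30)"
          using u' by (simp add: algebra_simps)
        moreover have "?m * ?m \<le> ?m + 4 * k"
          using acc False by simp
        ultimately show "?Q R' M' u'"
          using R' maxcut_iff_colouring[OF sub cover] by blast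
      qed
      with False show ?thesis by simp
    qed
  qed
  show ?thesis
    unfolding decide_maxcut_def
    apply (simp only: wp_Seq)
    apply (rule wp_setup_env[OF R M])
    apply (simp only: wp_Seq)
    apply (rule wp_match_edges[OF simple indep])
         apply assumption+
     apply (rule lay)
    subgoal premises p for R' u' R2 M2 u2
    proof -
      have "R2 rOne = 1" "R2 rK = k" using p(6) by (simp_all add: matched_def env_def)
      moreover have "u2 + 3 \<le> 15 * (n * n) + 7 * n + 12" using p by simp
      ultimately show ?thesis
        using final[OF p(6), of "u2 + 3"] by (simp del: wp_If add: numeral_3_eq_3)
    qed
    done
qed

section \<open>Input encoding and the final time bound\<close>

lemma nth_concat_uniform:
  assumes "\<forall>xs\<in>set xss. length xs = n" "i < length xss" "j < n"
  shows "concat xss ! (i * n + j) = xss ! i ! j"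
  using assms
proof (induction xss arbitrary: i)
  case (Cons xs xss)
  then show ?case by (cases i) (auto simp: nth_append)
qed simp

lemma length_instance_encoding: "length (instance_encoding n E k) = n * n + 2"
  by (simp add: instance_encoding_def length_concat comp_def sum_list_triv)

lemma layout_initial_state:
  "layout n E (snd (initial_state (instance_encoding n E k))) (\<lambda>_. 0)"
proof -
  have "instance_encoding n E k ! (2 + i * n + j) = of_bool ({i, j} \<in> E)"
    if ij: "i < n" "j < n" for i j
    using ij nth_concat_uniform[of
        "map (\<lambda>i. map (\<lambda>j. if {i, j} \<in> E then 1 else 0 :: nat) [0..<n]) [0..<n]" n i j]
    by (simp add: instance_encoding_def)
  then show ?thesis
    using matrix_index_less[of _ n]
    by (auto simp: layout_def initial_state_def length_instance_encoding)
qed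

lemma length_le_input_size: "length xs \<le> input_size xs"
  unfolding input_size_def by (induction xs) auto

text \<open>For positive \<open>m\<close> the hypothesis gives (m - 1)^2 \<le> 4 k - m + 1 \<le> 4
  k, so 2 m \<le> 2 + 4 sqrt k. The additive 2 becomes the factor 4, which is left to the
  polynomial.\<close>

lemma search_space_bound:
  fixes m k :: nat
  assumes "m * m \<le> m + 4 * k"
  shows "4 ^ m \<le> 4 * 2 powr (4 * sqrt (real k))"
proof -
  have "real m - 1 \<le> 2 * sqrt (real k)"
  proof (cases "m = 0")
    case False
    have "real m * real m \<le> real m + 4 * real k"
      using assms by (metis of_nat_add of_nat_le_iff of_nat_mult of_nat_numeral)
    with False have "(real m - 1)\<^sup>2 \<le> 4 * real k"
      by (simp add: power2_eq_square algebra_simps)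
    then have "\<bar>real m - 1\<bar> \<le> sqrt (4 * real k)"
      by (metis real_sqrt_abs real_sqrt_le_iff)
    then show ?thesis by (simp add: real_sqrt_mult)
  qed (simp add: order_trans[of _ 0])
  then have "2 powr (2 * real m) \<le> 2 powr (2 + 4 * sqrt (real k))"
    by simp
  also have "\<dots> = 4 * 2 powr (4 * sqrt (real k))"
    by (simp add: powr_add)
  also have "2 powr (2 * real m) = 4 ^ m"
    by (simp add: powr_powr[symmetric] powr_realpow)
  finally show ?thesis .
qed

theorem theorem2:
  shows "\<exists>(P :: com) (f :: nat \<Rightarrow> real) (p :: real poly).
    f \<in> O(\<lambda>k. sqrt (real k)) \<and>
    (\<forall>n E k. split_graph {..<n} E \<longrightarrow>
       (let x = instance_encoding n E k in
          answers_within P x (maxcut {..<n} E k)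
            (2 powr f k * poly p (real (input_size x)))))"
proof (intro exI[of _ decide_maxcut] exI[of _ "\<lambda>k. 4 * sqrt (real k)"] exI[of _ "[:0, 224:]"]
    conjI allI impI)
  show "(\<lambda>k. 4 * sqrt (real k)) \<in> O(\<lambda>k. sqrt (real k))"
    by simp
  fix n k :: nat and E
  assume split: "split_graph {..<n} E"
  define x where "x = instance_encoding n E k"
  have "wp decide_maxcut (\<lambda>R' M' u'. (R' rAns \<noteq> 0 \<longleftrightarrow> maxcut {..<n} E k) \<and>
      (\<exists>m. m * m \<le> m + 4 * k \<and> u' \<le> 4 ^ m * (26 * (n * n) + 30 * n + 30)))
      (fst (initial_state x)) (snd (initial_state x)) 0"
  proof (rule wp_decide_maxcut[OF split])
    show "layout n E (snd (initial_state x)) (\<lambda>_. 0)"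
      unfolding x_def by (rule layout_initial_state)
  qed (simp_all add: x_def initial_state_def instance_encoding_def)
  then obtain t R M m where
    exec: "exec decide_maxcut (initial_state x) t (R, M)" "R rAns \<noteq> 0 \<longleftrightarrow> maxcut {..<n} E k"
    and m: "m * m \<le> m + 4 * k" and t: "t \<le> 4 ^ m * (26 * (n * n) + 30 * n + 30)"
    by (auto elim!: wpE)
  \<comment> \<open>The matrix alone contributes \<open>n * n\<close> digits, and 56 = 26 + 30
    because n \<le> n^2; the factor 4 of the search space turns 56 into 224.\<close>
  have size: "26 * (n * n) + 30 * n + 30 \<le> 56 * input_size x"
  proof -
    have "n * n + 2 \<le> input_size x"
      using length_le_input_size[of x] by (simp add: x_def length_instance_encoding)
    with le_square[of n] show ?thesis by linarith
  qed
  have "t \<le> 4 ^ m * (56 * input_size x)"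
    by (rule order_trans[OF t mult_le_mono2[OF size]])
  then have "real t \<le> real (4 ^ m * (56 * input_size x))"
    by (rule of_nat_mono)
  also have "\<dots> = 4 ^ m * (56 * real (input_size x))"
    by simp
  also have "\<dots> \<le> (4 * 2 powr (4 * sqrt (real k))) * (56 * real (input_size x))"
    by (intro mult_right_mono search_space_bound m) auto
  finally have "real t \<le> 2 powr (4 * sqrt (real k)) * poly [:0, 224:] (real (input_size x))"
    by simp
  with exec show "let x = instance_encoding n E k in
      answers_within decide_maxcut x (maxcut {..<n} E k)
        (2 powr (4 * sqrt (real k)) * poly [:0, 224:] (real (input_size x)))"
    unfolding answers_within_def Let_def x_def by blast
qed

end
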